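(* The assignment $$\phi(X_{ij})=\sum_{h=1}^{l_i}a^i_{jh}X_{ih}+\psi_{ij}(\mathbf{X_1},\ldots,\mathbf{X_{i-1}})\qquad(1\le i\le n,\ 1\le j\le l_i),$$ where, for all $i,j$, $\psi_{ij}$ is a homogeneous polynomial in $R_{[i-1]}$ of degree $q_i$ and $A_i=(a^i_{jh})_{j,h=1,\ldots,l_i}\in M_{l_i}(K)$ is an invertible matrix, defines a graded automorphism of $R$. Vice versa, every graded automorphism of $R$ is of this kind.
   Context: $K$ is an infinite field of characteristic $0$ and $R=K[\mathbf{X_1},\ldots,\mathbf{X_n}]$ is a polynomial ring in the groups of variables $\mathbf{X_i}=(X_{i1},\ldots,X_{il_i})$, graded by $\deg X_{ij}=q_i$ for $j=1,\ldots,l_i$, where $0<q_1<q_2<\cdots<q_n$ are integers. $R_{[i]}=K[\mathbf{X_1},\ldots,\mathbf{X_i}]$, with $R_{[0]}=K$. A graded automorphism is a degree-preserving $K$-algebra automorphism. The zero polynomial is regarded as homogeneous of every degree (so $\psi_{1j}=0$). *)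

theory Defs
  imports
    "HOL-Library.Poly_Mapping"
    "Jordan_Normal_Form.Matrix"
begin

text \<open>
  Polynomials are finitely supported maps from monomials to coefficients, a monomial being
  a finitely supported exponent vector; the product is convolution. The variable
  \<open>X i j\<close> is the \<open>j\<close>-th variable of the \<open>i\<close>-th group, both indices starting from 1. The type
  has infinitely many variables; the ring \<open>K[X\<^sub>1, \<dots>, X\<^sub>m]\<close> in the first \<open>m\<close> groups, of
  sizes \<open>l 1, \<dots>, l m\<close>, is cut out as the subset \<open>poly_ring l m\<close>.
\<close>

type_synonym monomial = "(nat \<times> nat) \<Rightarrow>\<^sub>0 nat"
type_synonym 'k mpoly = "monomial \<Rightarrow>\<^sub>0 'k"

definition Const :: "'k::zero \<Rightarrow> 'k mpoly" where
  "Const c = Poly_Mapping.single 0 c"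

definition X :: "nat \<Rightarrow> nat \<Rightarrow> 'k::zero_neq_one mpoly" where
  "X i j = Poly_Mapping.single (Poly_Mapping.single (i, j) 1) 1"

definition poly_ring :: "(nat \<Rightarrow> nat) \<Rightarrow> nat \<Rightarrow> 'k::zero mpoly set" where
  "poly_ring l m =
     {p. \<forall>t \<in> Poly_Mapping.keys p. Poly_Mapping.keys t \<subseteq> (SIGMA i:{1..m}. {1..l i})}"

definition monomial_degree :: "(nat \<Rightarrow> nat) \<Rightarrow> monomial \<Rightarrow> nat" where
  "monomial_degree q t = (\<Sum>(i, j) \<in> Poly_Mapping.keys t. Poly_Mapping.lookup t (i, j) * q i)"

text \<open>The zero polynomial is homogeneous of every degree.\<close>

definition homogeneous :: "(nat \<Rightarrow> nat) \<Rightarrow> nat \<Rightarrow> 'k::zero mpoly \<Rightarrow> bool" where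
  "homogeneous q d p \<longleftrightarrow> (\<forall>t \<in> Poly_Mapping.keys p. monomial_degree q t = d)"

text \<open>
  Maps of \<open>poly_ring l n\<close> are represented by functions on the whole type, whose values outside
  \<open>poly_ring l n\<close> are irrelevant. Compatibility with \<open>K\<close> is expressed by fixing the constants,
  which contains \<open>\<phi> 1 = 1\<close> and, with multiplicativity, \<open>K\<close>-linearity.
\<close>

definition algebra_endomorphism ::
    "(nat \<Rightarrow> nat) \<Rightarrow> nat \<Rightarrow> ('k::comm_ring_1 mpoly \<Rightarrow> 'k mpoly) \<Rightarrow> bool" where
  "algebra_endomorphism l n \<phi> \<longleftrightarrow>
     (\<forall>p \<in> poly_ring l n. \<phi> p \<in> poly_ring l n) \<and>
     (\<forall>p \<in> poly_ring l n. \<forall>r \<in> poly_ring l n. \<phi> (p + r) = \<phi> p + \<phi> r) \<and>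
     (\<forall>p \<in> poly_ring l n. \<forall>r \<in> poly_ring l n. \<phi> (p * r) = \<phi> p * \<phi> r) \<and>
     (\<forall>c. \<phi> (Const c) = Const c)"

definition graded_automorphism ::
    "(nat \<Rightarrow> nat) \<Rightarrow> (nat \<Rightarrow> nat) \<Rightarrow> nat \<Rightarrow> ('k::comm_ring_1 mpoly \<Rightarrow> 'k mpoly) \<Rightarrow> bool" where
  "graded_automorphism q l n \<phi> \<longleftrightarrow>
     algebra_endomorphism l n \<phi> \<and>
     bij_betw \<phi> (poly_ring l n) (poly_ring l n) \<and>
     (\<forall>d. \<forall>p \<in> poly_ring l n. homogeneous q d p \<longrightarrow> homogeneous q d (\<phi> p))"

definition admissible_data ::
    "(nat \<Rightarrow> nat) \<Rightarrow> (nat \<Rightarrow> nat) \<Rightarrow> nat \<Rightarrow> (nat \<Rightarrow> 'k::comm_ring_1 mat) \<Rightarrow>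
     (nat \<Rightarrow> nat \<Rightarrow> 'k mpoly) \<Rightarrow> bool" where
  "admissible_data q l n A \<psi> \<longleftrightarrow>
     (\<forall>i \<in> {1..n}. A i \<in> carrier_mat (l i) (l i) \<and> invertible_mat (A i)) \<and>
     (\<forall>i \<in> {1..n}. \<forall>j \<in> {1..l i}. \<psi> i j \<in> poly_ring l (i - 1) \<and> homogeneous q (q i) (\<psi> i j))"

text \<open>Matrix entries are indexed from 0, hence the shift in \<open>a\<^sup>i\<^sub>j\<^sub>h = A i $$ (j - 1, h - 1)\<close>.\<close>

definition has_assignment ::
    "(nat \<Rightarrow> nat) \<Rightarrow> nat \<Rightarrow> (nat \<Rightarrow> 'k::comm_ring_1 mat) \<Rightarrow> (nat \<Rightarrow> nat \<Rightarrow> 'k mpoly) \<Rightarrow>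
     ('k mpoly \<Rightarrow> 'k mpoly) \<Rightarrow> bool" where
  "has_assignment l n A \<psi> \<phi> \<longleftrightarrow>
     (\<forall>i \<in> {1..n}. \<forall>j \<in> {1..l i}.
        \<phi> (X i j) = (\<Sum>h = 1..l i. Const (A i $$ (j - 1, h - 1)) * X i h) + \<psi> i j)"

end

theory Submission
  imports Defs "Jordan_Normal_Form.Determinant"
begin

text \<open>
  \<^emph>\<open>A triangular assignment gives a graded automorphism.\<close> Call a substitution elementary if it
  moves the variables of a single group \<open>m\<close> only, sending \<open>X\<^sub>m\<close> to \<open>A X\<^sub>m + \<psi>\<close> with \<open>A\<close> invertible
  and \<open>\<psi>\<close> in the earlier groups. It leaves \<open>\<psi>\<close> unchanged, so the substitution
  \<open>X\<^sub>m \<mapsto> A\<^sup>-\<^sup>1 (X\<^sub>m - \<psi>)\<close> is its inverse (\<open>elementary_automorphism\<close>). A general triangular assignment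
  is the composition \<open>E\<^sub>n \<circ> \<dots> \<circ> E\<^sub>1\<close> of its elementary parts: when \<open>E\<^sub>i\<close> has been applied, \<open>X\<^sub>i\<close> has
  become a polynomial in the first \<open>i\<close> groups, which no later factor touches
  (\<open>triangular_automorphism_exists\<close>). The variables and the constants generate the ring, so an
  endomorphism is determined by the assignment (\<open>algebra_endomorphism_eqI\<close>).

  \<^emph>\<open>A graded automorphism is triangular.\<close> Since the weights are positive and strictly increasing, a
  monomial of degree \<open>q i\<close> that contains a variable of a group \<open>i' \<ge> i\<close> can contain nothing else, and
  \<open>i' = i\<close>. Hence a homogeneous polynomial of degree \<open>q i\<close> is a linear form in \<open>X\<^sub>i\<close> plus a
  polynomial in the earlier groups (\<open>homogeneous_decomposition\<close>); applied to \<open>\<phi> (X i j)\<close> this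
  yields the matrices \<open>A\<^sub>i\<close> and the polynomials \<open>\<psi>\<close>. It remains to invert \<open>A\<^sub>i\<close>. The coefficients of
  \<open>\<phi> p\<close> at the variables of group \<open>i\<close> depend only on the coefficients of \<open>p\<close> at these variables, and
  the dependence is multiplication by \<open>A\<^sub>i\<close> (\<open>linear_coefficients_image\<close>). If \<open>p\<close> runs through
  preimages of the \<open>X i j\<close>, the coefficients of \<open>p\<close> form a matrix \<open>B\<close> with \<open>B A\<^sub>i = 1\<close>, and over a
  field a left inverse of a square matrix is an inverse.
\<close>

section \<open>Monomials and their degrees\<close>

lemma monomial_degree_alt:
  "monomial_degree q t =
     (\<Sum>v \<in> Poly_Mapping.keys t. Poly_Mapping.lookup t v * q (fst v))"
  unfolding monomial_degree_def by (rule sum.cong) auto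

lemma monomial_degree_0 [simp]: "monomial_degree q 0 = 0"
  by (simp add: monomial_degree_alt)

lemma monomial_degree_variable [simp]:
  "monomial_degree q (Poly_Mapping.single (i, j) (Suc 0)) = q i"
  by (simp add: monomial_degree_alt)

lemma monomial_degree_add:
  "monomial_degree q (s + t) = monomial_degree q s + monomial_degree q t"
  unfolding monomial_degree_alt
  by (rule setsum_keys_plus_distrib) (auto simp: algebra_simps)

lemma monomial_degree_pos:
  assumes "\<And>v. v \<in> Poly_Mapping.keys t \<Longrightarrow> 0 < q (fst v)" and "t \<noteq> 0"
  shows "0 < monomial_degree q t"
proof -
  from assms(2) obtain v where v: "v \<in> Poly_Mapping.keys t"
    using keys_eq_empty by blast
  with assms(1) show ?thesis
    unfolding monomial_degree_alt
    by (intro sum_pos2[OF _ v]) (auto simp: in_keys_iff)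
qed

lemma monomial_split:
  fixes t :: monomial
  assumes "v \<in> Poly_Mapping.keys t"
  obtains t' where "t = Poly_Mapping.single v (Suc 0) + t'"
    and "Poly_Mapping.keys t' \<subseteq> Poly_Mapping.keys t"
proof
  show "t = Poly_Mapping.single v (Suc 0) + (t - Poly_Mapping.single v (Suc 0))"
    using assms
    by (intro poly_mapping_eqI)
      (auto simp: lookup_add lookup_minus lookup_single when_def in_keys_iff)
  show "Poly_Mapping.keys (t - Poly_Mapping.single v (Suc 0)) \<subseteq> Poly_Mapping.keys t"
    by (auto simp: in_keys_iff lookup_minus)
qed

text \<open>
  A variable is an irreducible monomial. This is why the product of two polynomials without constant
  term has no linear terms.
\<close>

lemma variable_eq_add:
  fixes s t :: monomial
  assumes "Poly_Mapping.single v (Suc 0) = s + t"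
  shows "s = 0 \<or> t = 0"
proof (rule ccontr)
  assume "\<not> ?thesis"
  then obtain a b where a: "a \<in> Poly_Mapping.keys s" and b: "b \<in> Poly_Mapping.keys t"
    using keys_eq_empty by blast
  have eq: "(Suc 0 when v = w) = Poly_Mapping.lookup s w + Poly_Mapping.lookup t w" for w
    using arg_cong[OF assms, of "\<lambda>u. Poly_Mapping.lookup u w"]
    by (simp add: lookup_add lookup_single)
  from eq[of a] a have "v = a"
    by (cases "v = a") (auto simp: in_keys_iff)
  moreover from eq[of b] b have "v = b"
    by (cases "v = b") (auto simp: in_keys_iff)
  ultimately show False
    using eq[of v] a b by (auto simp: in_keys_iff)
qed

lemma single_variable_eq_iff:
  "Poly_Mapping.single v (Suc 0) = Poly_Mapping.single w (Suc 0) \<longleftrightarrow> v = w"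
proof
  assume "Poly_Mapping.single v (Suc 0) = Poly_Mapping.single w (Suc 0)"
  then have "Poly_Mapping.keys (Poly_Mapping.single v (Suc 0)) =
      Poly_Mapping.keys (Poly_Mapping.single w (Suc 0))"
    by (rule arg_cong)
  then show "v = w" by simp
qed simp


section \<open>The polynomial rings\<close>

lemma Const_0 [simp]: "Const 0 = 0"
  by (simp add: Const_def)

lemma Const_1 [simp]: "Const 1 = 1"
  by (simp add: Const_def)

lemma Const_add: "Const (a + b) = Const a + Const b"
  by (simp add: Const_def single_add)

lemma Const_mult: "Const (a * b) = Const a * Const b" for a b :: "'k::comm_ring_1"
  by (simp add: Const_def mult_single)

lemma Const_sum: "Const (sum f S) = (\<Sum>x\<in>S. Const (f x))"
  by (induction S rule: infinite_finite_induct) (auto simp: Const_add)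

lemma lookup_Const_mult:
  "Poly_Mapping.lookup (Const c * p) t = c * Poly_Mapping.lookup p t"
  for p :: "'k::comm_ring_1 mpoly"
  unfolding Const_def mult_map_scale_conv_mult[symmetric]
  by (simp add: map.rep_eq when_def)

lemma single_eq_Const_mult:
  "Poly_Mapping.single t c = Const c * Poly_Mapping.single t (1::'k::comm_ring_1)"
  by (simp add: Const_def mult_single)

lemma lookup_variable:
  "Poly_Mapping.lookup (X i j) (Poly_Mapping.single v (Suc 0)) = (if v = (i, j) then 1 else 0)"
  by (auto simp: X_def lookup_single when_def single_variable_eq_iff)

lemma poly_ringI:
  assumes "\<And>t. t \<in> Poly_Mapping.keys p \<Longrightarrow> Poly_Mapping.keys t \<subseteq> (SIGMA i:{1..m}. {1..l i})"
  shows "p \<in> poly_ring l m"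
  using assms by (auto simp: poly_ring_def)

lemma poly_ringD:
  assumes "p \<in> poly_ring l m" "t \<in> Poly_Mapping.keys p"
  shows "Poly_Mapping.keys t \<subseteq> (SIGMA i:{1..m}. {1..l i})"
  using assms by (auto simp: poly_ring_def)

lemma poly_ring_Const [intro, simp]: "Const c \<in> poly_ring l m"
  by (rule poly_ringI) (auto simp: Const_def split: if_splits)

lemma poly_ring_X [intro, simp]:
  "i \<in> {1..m} \<Longrightarrow> j \<in> {1..l i} \<Longrightarrow> (X i j :: 'k::zero_neq_one mpoly) \<in> poly_ring l m"
  by (rule poly_ringI) (auto simp: X_def)

lemma poly_ring_0 [intro, simp]: "0 \<in> poly_ring l m"
  by (rule poly_ringI) auto

lemma poly_ring_add [intro!]:
  "p \<in> poly_ring l m \<Longrightarrow> r \<in> poly_ring l m \<Longrightarrow> p + r \<in> poly_ring l m"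
  unfolding poly_ring_def using keys_add[of p r] by blast

lemma poly_ring_diff [intro!]:
  "p \<in> poly_ring l m \<Longrightarrow> r \<in> poly_ring l m \<Longrightarrow> p - r \<in> poly_ring l m"
  for p r :: "'k::comm_ring_1 mpoly"
  unfolding poly_ring_def using keys_diff[of p r] by blast

lemma poly_ring_mult [intro!]:
  fixes p r :: "'k::comm_ring_1 mpoly"
  assumes p: "p \<in> poly_ring l m" and r: "r \<in> poly_ring l m"
  shows "p * r \<in> poly_ring l m"
proof (rule poly_ringI)
  fix t assume "t \<in> Poly_Mapping.keys (p * r)"
  then obtain a b where "t = a + b" "a \<in> Poly_Mapping.keys p" "b \<in> Poly_Mapping.keys r"
    using keys_mult by blast
  then show "Poly_Mapping.keys t \<subseteq> (SIGMA i:{1..m}. {1..l i})"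
    using poly_ringD[OF p] poly_ringD[OF r] keys_add[of a b] by blast
qed

lemma poly_ring_sum [intro!]:
  "(\<And>x. x \<in> S \<Longrightarrow> f x \<in> poly_ring l m) \<Longrightarrow> sum f S \<in> poly_ring l m"
  by (induction S rule: infinite_finite_induct) auto

lemma poly_ring_mono:
  assumes "m \<le> m'" "p \<in> poly_ring l m"
  shows "p \<in> poly_ring l m'"
  by (rule poly_ringI) (use poly_ringD[OF assms(2)] assms(1) in fastforce)

lemma sum_of_terms:
  "p = (\<Sum>t \<in> Poly_Mapping.keys p. Poly_Mapping.single t (Poly_Mapping.lookup p t))"
  by (rule poly_mapping_eqI) (auto simp: lookup_sum lookup_single when_def in_keys_iff)

text \<open>
  Induction over the terms of a polynomial, for additive properties. Keeping the monomials
  in a set \<open>T\<close> keeps all partial sums inside a subring such as \<open>poly_ring l m\<close>.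
\<close>

lemma poly_terms_induct:
  fixes p :: "'k::comm_ring_1 mpoly"
  assumes p: "Poly_Mapping.keys p \<subseteq> T"
    and zero: "P 0"
    and single: "\<And>t c. t \<in> T \<Longrightarrow> P (Poly_Mapping.single t c)"
    and add: "\<And>p r. Poly_Mapping.keys p \<subseteq> T \<Longrightarrow> Poly_Mapping.keys r \<subseteq> T \<Longrightarrow>
      P p \<Longrightarrow> P r \<Longrightarrow> P (p + r)"
  shows "P p"
proof -
  let ?s = "\<lambda>t. Poly_Mapping.single t (Poly_Mapping.lookup p t)"
  have "finite S \<Longrightarrow> S \<subseteq> T \<Longrightarrow> Poly_Mapping.keys (sum ?s S) \<subseteq> T \<and> P (sum ?s S)" for S
  proof (induction S rule: finite_induct)
    case (insert t S)
    then have "Poly_Mapping.keys (?s t) \<subseteq> T" "Poly_Mapping.keys (sum ?s S) \<subseteq> T"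
      by auto
    then show ?case
      using insert add[of "?s t" "sum ?s S"] single[of t] keys_add[of "?s t" "sum ?s S"] by auto
  qed (simp add: zero)
  with p show ?thesis
    using sum_of_terms[of p] by (metis finite_keys)
qed

text \<open>
  The ring is generated by the constants and the variables: a term is split into one variable
  and a term of smaller total degree.
\<close>

lemma poly_ring_induct [consumes 1, case_names Const X add mult]:
  fixes p :: "'k::comm_ring_1 mpoly"
  assumes p: "p \<in> poly_ring l m"
    and Const: "\<And>c. P (Const c)"
    and X: "\<And>i j. i \<in> {1..m} \<Longrightarrow> j \<in> {1..l i} \<Longrightarrow> P (X i j)"
    and add: "\<And>p r. p \<in> poly_ring l m \<Longrightarrow> r \<in> poly_ring l m \<Longrightarrow> P p \<Longrightarrow> P r \<Longrightarrow> P (p + r)"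
    and mult: "\<And>p r. p \<in> poly_ring l m \<Longrightarrow> r \<in> poly_ring l m \<Longrightarrow> P p \<Longrightarrow> P r \<Longrightarrow> P (p * r)"
  shows "P p"
proof -
  let ?V = "SIGMA i:{1..m}. {1..l i}"
  have single: "P (Poly_Mapping.single t c)" if "Poly_Mapping.keys t \<subseteq> ?V" for t :: monomial and c :: 'k
    using that
  proof (induction "monomial_degree (\<lambda>_. 1) t" arbitrary: t rule: less_induct)
    case less
    show ?case
    proof (cases "t = 0")
      case True
      then show ?thesis using Const[of c] by (simp add: Const_def)
    next
      case False
      then obtain v where v: "v \<in> Poly_Mapping.keys t"
        using keys_eq_empty by blast
      obtain i j where ij: "v = (i, j)" by (cases v)
      from v obtain t' where t: "t = Poly_Mapping.single v (Suc 0) + t'"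
        and t': "Poly_Mapping.keys t' \<subseteq> Poly_Mapping.keys t"
        by (rule monomial_split)
      \<comment> \<open>With all weights equal to 1 the degree is the number of factors, which drops by one.\<close>
      have "monomial_degree (\<lambda>_. 1) t = 1 + monomial_degree (\<lambda>_. 1) t'"
        unfolding t monomial_degree_add ij by simp
      then have "P (Poly_Mapping.single t' c)"
        using less t' by auto
      moreover have range: "i \<in> {1..m}" "j \<in> {1..l i}"
        using v less.prems ij by auto
      moreover have "Poly_Mapping.single t' c \<in> poly_ring l m"
        using t' less.prems by (intro poly_ringI) (auto split: if_splits)
      ultimately have "P (X i j * Poly_Mapping.single t' c)"
        by (intro mult X poly_ring_X)
      then show ?thesis
        by (simp add: X_def mult_single t ij)
    qed
  qed
  show ?thesis
  proof (rule poly_terms_induct[where T = "{t. Poly_Mapping.keys t \<subseteq> ?V}"])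
    show "Poly_Mapping.keys p \<subseteq> {t. Poly_Mapping.keys t \<subseteq> ?V}"
      using poly_ringD[OF p] by blast
    show "P 0" using Const[of 0] by simp
    fix t :: monomial and c :: 'k
    assume "t \<in> {t. Poly_Mapping.keys t \<subseteq> ?V}"
    then show "P (Poly_Mapping.single t c)" using single by blast
  next
    fix p r :: "'k mpoly"
    assume *: "Poly_Mapping.keys p \<subseteq> {t. Poly_Mapping.keys t \<subseteq> ?V}"
      "Poly_Mapping.keys r \<subseteq> {t. Poly_Mapping.keys t \<subseteq> ?V}" and P: "P p" "P r"
    from * have "p \<in> poly_ring l m" "r \<in> poly_ring l m"
      unfolding poly_ring_def by blast+
    then show "P (p + r)" using P by (rule add)
  qed
qed


section \<open>Homogeneous polynomials\<close>

lemma homogeneousD: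
  "homogeneous q d p \<Longrightarrow> t \<in> Poly_Mapping.keys p \<Longrightarrow> monomial_degree q t = d"
  by (auto simp: homogeneous_def)

lemma homogeneous_Const [intro, simp]: "homogeneous q 0 (Const c)"
  by (auto simp: homogeneous_def Const_def split: if_splits)

lemma homogeneous_X [intro, simp]: "homogeneous q (q i) (X i j)"
  by (auto simp: homogeneous_def X_def split: if_splits)

lemma homogeneous_1 [intro, simp]: "homogeneous q 0 (1 :: 'k::comm_ring_1 mpoly)"
  by (simp add: homogeneous_def)

lemma homogeneous_0 [intro, simp]: "homogeneous q d 0"
  by (simp add: homogeneous_def)

lemma homogeneous_add [intro!]:
  "homogeneous q d p \<Longrightarrow> homogeneous q d r \<Longrightarrow> homogeneous q d (p + r)"
  unfolding homogeneous_def using keys_add[of p r] by blast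

lemma homogeneous_diff [intro!]:
  "homogeneous q d p \<Longrightarrow> homogeneous q d r \<Longrightarrow> homogeneous q d (p - r)"
  for p r :: "'k::comm_ring_1 mpoly"
  unfolding homogeneous_def using keys_diff[of p r] by blast

lemma homogeneous_mult:
  fixes p r :: "'k::comm_ring_1 mpoly"
  assumes "homogeneous q d p" "homogeneous q e r"
  shows "homogeneous q (d + e) (p * r)"
  unfolding homogeneous_def
proof
  fix t assume "t \<in> Poly_Mapping.keys (p * r)"
  then obtain a b where "t = a + b" "a \<in> Poly_Mapping.keys p" "b \<in> Poly_Mapping.keys r"
    using keys_mult by blast
  with assms show "monomial_degree q t = d + e"
    by (auto simp: homogeneous_def monomial_degree_add)
qed

lemma homogeneous_Const_mult [intro!]:
  "homogeneous q d p \<Longrightarrow> homogeneous q d (Const c * p)" for p :: "'k::comm_ring_1 mpoly"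
  using homogeneous_mult[OF homogeneous_Const, of q d p c] by simp

lemma homogeneous_sum [intro!]:
  "(\<And>x. x \<in> S \<Longrightarrow> homogeneous q d (f x)) \<Longrightarrow> homogeneous q d (sum f S)"
  by (induction S rule: infinite_finite_induct) auto

lemma homogeneous_power:
  "homogeneous q d p \<Longrightarrow> homogeneous q (k * d) (p ^ k)" for p :: "'k::comm_ring_1 mpoly"
proof (induction k)
  case 0
  then show ?case by simp
next
  case (Suc k)
  then show ?case using homogeneous_mult[of q d p "k * d" "p ^ k"] by simp
qed

lemma homogeneous_prod:
  fixes f :: "'a \<Rightarrow> 'k::comm_ring_1 mpoly"
  assumes "\<And>x. x \<in> S \<Longrightarrow> homogeneous q (d x) (f x)"
  shows "homogeneous q (\<Sum>x\<in>S. d x) (\<Prod>x\<in>S. f x)"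
  using assms
proof (induction S rule: infinite_finite_induct)
  case (insert x S)
  then show ?case using homogeneous_mult[of q "d x" "f x"] by simp
qed auto


section \<open>Substitution of polynomials for the variables\<close>

definition monomial_subst :: "(nat \<times> nat \<Rightarrow> 'k::comm_ring_1 mpoly) \<Rightarrow> monomial \<Rightarrow> 'k mpoly" where
  "monomial_subst f t = (\<Prod>v \<in> Poly_Mapping.keys t. f v ^ Poly_Mapping.lookup t v)"

definition subst :: "(nat \<times> nat \<Rightarrow> 'k::comm_ring_1 mpoly) \<Rightarrow> 'k mpoly \<Rightarrow> 'k mpoly" where
  "subst f p = (\<Sum>t \<in> Poly_Mapping.keys p. Const (Poly_Mapping.lookup p t) * monomial_subst f t)"

lemma monomial_subst_add:
  "monomial_subst f (s + t) = monomial_subst f s * monomial_subst f t"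
proof -
  let ?K = "Poly_Mapping.keys s \<union> Poly_Mapping.keys t"
  have *: "monomial_subst f u = (\<Prod>v\<in>?K. f v ^ Poly_Mapping.lookup u v)"
    if "Poly_Mapping.keys u \<subseteq> ?K" for u
    unfolding monomial_subst_def
    by (rule prod.mono_neutral_left) (use that in \<open>auto simp: in_keys_iff\<close>)
  show ?thesis
    using *[of "s + t"] *[of s] *[of t] keys_add[of s t]
    by (simp add: lookup_add power_add prod.distrib)
qed

lemma subst_add: "subst f (p + r) = subst f p + subst f r"
  unfolding subst_def
  by (rule setsum_keys_plus_distrib) (auto simp: Const_add algebra_simps)

lemma subst_single: "subst f (Poly_Mapping.single t c) = Const c * monomial_subst f t"
  by (simp add: subst_def)

lemma subst_0 [simp]: "subst f 0 = 0"
  by (simp add: subst_def)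

lemma subst_Const [simp]: "subst f (Const c) = Const c"
  unfolding Const_def subst_single by (simp add: Const_def monomial_subst_def)

lemma subst_X [simp]: "subst f (X i j) = f (i, j)"
  by (simp add: X_def subst_single monomial_subst_def)

text \<open>
  Both sides are bilinear, so it suffices to compare them on terms, where the claim is that
  \<open>monomial_subst f\<close> turns sums of exponent vectors into products.
\<close>

lemma subst_mult: "subst f (p * r) = subst f p * subst f r"
proof (rule poly_terms_induct[where T = UNIV and p = p])
  fix s a
  show "subst f (Poly_Mapping.single s a * r) = subst f (Poly_Mapping.single s a) * subst f r"
  proof (rule poly_terms_induct[where T = UNIV and p = r])
    fix t b
    show "subst f (Poly_Mapping.single s a * Poly_Mapping.single t b) =
        subst f (Poly_Mapping.single s a) * subst f (Poly_Mapping.single t b)"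
      by (simp add: mult_single subst_single monomial_subst_add Const_mult algebra_simps)
  qed (auto simp: subst_add algebra_simps)
qed (auto simp: subst_add algebra_simps)

lemma subst_sum: "subst f (\<Sum>x\<in>S. g x) = (\<Sum>x\<in>S. subst f (g x))"
  by (induction S rule: infinite_finite_induct) (auto simp: subst_add)

lemma subst_diff: "subst f (p - r) = subst f p - subst f r"
  using subst_add[of f "p - r" r] by simp

lemma subst_eq_self:
  assumes "p \<in> poly_ring l m"
    and "\<And>i j. i \<in> {1..m} \<Longrightarrow> j \<in> {1..l i} \<Longrightarrow> f (i, j) = X i j"
  shows "subst f p = p"
  using assms(1)
  by (induction rule: poly_ring_induct) (auto simp: assms(2) subst_add subst_mult)

lemma algebra_endomorphism_subst:
  assumes "\<And>i j. i \<in> {1..n} \<Longrightarrow> j \<in> {1..l i} \<Longrightarrow> f (i, j) \<in> poly_ring l n"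
  shows "algebra_endomorphism l n (subst f)"
proof -
  have "subst f p \<in> poly_ring l n" if "p \<in> poly_ring l n" for p
    using that by (induction rule: poly_ring_induct) (auto simp: assms subst_add subst_mult)
  then show ?thesis
    by (simp add: algebra_endomorphism_def subst_add subst_mult)
qed

lemma homogeneous_subst:
  assumes f: "\<And>i j. i \<in> {1..n} \<Longrightarrow> j \<in> {1..l i} \<Longrightarrow> homogeneous q (q i) (f (i, j))"
    and p: "p \<in> poly_ring l n" "homogeneous q d p"
  shows "homogeneous q d (subst f p)"
  unfolding subst_def
proof (intro homogeneous_sum homogeneous_Const_mult)
  fix t assume t: "t \<in> Poly_Mapping.keys p"
  have "homogeneous q (\<Sum>v\<in>Poly_Mapping.keys t. Poly_Mapping.lookup t v * q (fst v))
      (monomial_subst f t)"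
    unfolding monomial_subst_def
  proof (intro homogeneous_prod homogeneous_power)
    fix v assume "v \<in> Poly_Mapping.keys t"
    then show "homogeneous q (q (fst v)) (f v)"
      using f[of "fst v" "snd v"] poly_ringD[OF p(1) t] by auto
  qed
  then show "homogeneous q d (monomial_subst f t)"
    using homogeneousD[OF p(2) t] by (simp add: monomial_degree_alt)
qed


section \<open>Endomorphisms and graded automorphisms\<close>

lemma algebra_endomorphism_comp:
  "algebra_endomorphism l n \<phi> \<Longrightarrow> algebra_endomorphism l n \<rho> \<Longrightarrow>
    algebra_endomorphism l n (\<phi> \<circ> \<rho>)"
  by (simp add: algebra_endomorphism_def)

lemma algebra_endomorphism_id: "algebra_endomorphism l n (\<lambda>p. p)"
  by (auto simp: algebra_endomorphism_def)

lemma algebra_endomorphism_eqI: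
  assumes \<phi>: "algebra_endomorphism l n \<phi>" and \<rho>: "algebra_endomorphism l n \<rho>"
    and eq: "\<And>i j. i \<in> {1..n} \<Longrightarrow> j \<in> {1..l i} \<Longrightarrow> \<phi> (X i j) = \<rho> (X i j)"
    and p: "p \<in> poly_ring l n"
  shows "\<phi> p = \<rho> p"
  using p
  by (induction rule: poly_ring_induct) (use \<phi> \<rho> eq in \<open>auto simp: algebra_endomorphism_def\<close>)

lemma bij_betw_if_inverse_on_variables:
  assumes \<phi>: "algebra_endomorphism l n \<phi>" and \<rho>: "algebra_endomorphism l n \<rho>"
    and "\<And>i j. i \<in> {1..n} \<Longrightarrow> j \<in> {1..l i} \<Longrightarrow> \<rho> (\<phi> (X i j)) = X i j"
    and "\<And>i j. i \<in> {1..n} \<Longrightarrow> j \<in> {1..l i} \<Longrightarrow> \<phi> (\<rho> (X i j)) = X i j"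
  shows "bij_betw \<phi> (poly_ring l n) (poly_ring l n)"
proof (rule bij_betw_byWitness[where f' = \<rho>])
  show "\<forall>p\<in>poly_ring l n. \<rho> (\<phi> p) = p"
    using algebra_endomorphism_eqI[OF algebra_endomorphism_comp[OF \<rho> \<phi>] algebra_endomorphism_id]
      assms(3) by fastforce
  show "\<forall>p\<in>poly_ring l n. \<phi> (\<rho> p) = p"
    using algebra_endomorphism_eqI[OF algebra_endomorphism_comp[OF \<phi> \<rho>] algebra_endomorphism_id]
      assms(4) by fastforce
qed (use \<phi> \<rho> in \<open>auto simp: algebra_endomorphism_def\<close>)

lemma graded_automorphism_id: "graded_automorphism q l n (\<lambda>p. p)"
  by (simp add: graded_automorphism_def algebra_endomorphism_id bij_betw_def)

lemma graded_automorphism_comp: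
  assumes "graded_automorphism q l n \<phi>" "graded_automorphism q l n \<rho>"
  shows "graded_automorphism q l n (\<phi> \<circ> \<rho>)"
  using assms bij_betw_trans[of \<rho> "poly_ring l n" "poly_ring l n" \<phi> "poly_ring l n"]
  by (auto simp: graded_automorphism_def algebra_endomorphism_comp)
    (auto simp: algebra_endomorphism_def)


section \<open>Triangular assignments define graded automorphisms\<close>

lemma sum_mat_mult_index:
  fixes A B :: "'k::comm_ring_1 mat"
  assumes "A \<in> carrier_mat N N" "B \<in> carrier_mat N N" "j \<in> {1..N}" "h \<in> {1..N}"
  shows "(\<Sum>k = 1..N. A $$ (j - 1, k - 1) * B $$ (k - 1, h - 1)) = (A * B) $$ (j - 1, h - 1)"
proof -
  have "(\<Sum>k = 1..N. A $$ (j - 1, k - 1) * B $$ (k - 1, h - 1)) =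
      (\<Sum>k = 0..<N. A $$ (j - 1, k) * B $$ (k, h - 1))"
    by (rule sum.reindex_bij_witness[of _ Suc "\<lambda>k. k - 1"]) auto
  also have "\<dots> = (A * B) $$ (j - 1, h - 1)"
    using assms by (auto simp: scalar_prod_def)
  finally show ?thesis .
qed

text \<open>
  Substituting one system of linear forms into another multiplies their matrices. The arguments
  \<open>Y h\<close> are arbitrary polynomials, since in an elementary substitution they are once the variables
  and once the variables minus \<open>\<psi>\<close>.
\<close>

lemma inverse_linear_forms:
  fixes A B :: "'k::comm_ring_1 mat"
  assumes A: "A \<in> carrier_mat N N" and B: "B \<in> carrier_mat N N" and BA: "B * A = 1\<^sub>m N"
    and j: "j \<in> {1..N}"
  shows "(\<Sum>k = 1..N. Const (B $$ (j - 1, k - 1)) *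
      (\<Sum>h = 1..N. Const (A $$ (k - 1, h - 1)) * Y h)) = Y j"
proof -
  have "(\<Sum>k = 1..N. Const (B $$ (j - 1, k - 1)) *
        (\<Sum>h = 1..N. Const (A $$ (k - 1, h - 1)) * Y h)) =
      (\<Sum>h = 1..N. Const (\<Sum>k = 1..N. B $$ (j - 1, k - 1) * A $$ (k - 1, h - 1)) * Y h)"
    unfolding Const_sum Const_mult sum_distrib_left sum_distrib_right
    by (subst sum.swap) (simp add: mult.assoc)
  also have "\<dots> = (\<Sum>h = 1..N. if h = j then Y h else 0)"
  proof (rule sum.cong)
    fix h assume h: "h \<in> {1..N}"
    show "Const (\<Sum>k = 1..N. B $$ (j - 1, k - 1) * A $$ (k - 1, h - 1)) * Y h =
        (if h = j then Y h else 0)"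
      unfolding sum_mat_mult_index[OF B A j h] BA using j h by auto
  qed simp
  also have "\<dots> = Y j" using j by simp
  finally show ?thesis .
qed

text \<open>
  The substitutions \<open>f\<close>, given by \<open>X\<^sub>m \<mapsto> A X\<^sub>m + \<psi>\<close>, and \<open>g\<close>, given by
  \<open>X\<^sub>m \<mapsto> B (X\<^sub>m - \<psi>)\<close> with \<open>B = A\<^sup>-\<^sup>1\<close>, both fix \<open>\<psi>\<close>, because \<open>\<psi>\<close> involves earlier groups
  only. Hence they are inverse to each other.
\<close>

lemma elementary_automorphism:
  fixes A :: "'k::comm_ring_1 mat"
  assumes m: "m \<in> {1..n}"
    and A: "A \<in> carrier_mat (l m) (l m)" "invertible_mat A"
    and \<psi>: "\<And>j. j \<in> {1..l m} \<Longrightarrow> \<psi> j \<in> poly_ring l (m - 1)"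
      "\<And>j. j \<in> {1..l m} \<Longrightarrow> homogeneous q (q m) (\<psi> j)"
  shows "\<exists>E. graded_automorphism q l n E \<and>
    (\<forall>j \<in> {1..l m}. E (X m j) = (\<Sum>h = 1..l m. Const (A $$ (j - 1, h - 1)) * X m h) + \<psi> j) \<and>
    (\<forall>i j. i \<noteq> m \<longrightarrow> E (X i j) = X i j) \<and>
    (\<forall>p \<in> poly_ring l (m - 1). E p = p)"
proof -
  obtain B where AB: "A * B = 1\<^sub>m (l m)" and BA: "B * A = 1\<^sub>m (dim_row B)"
    using A by (auto simp: invertible_mat_def inverts_mat_def)
  have "dim_col B = l m"
    using arg_cong[OF AB, of dim_col] by simp
  moreover have "dim_row B = l m"
    using arg_cong[OF BA, of dim_col] A(1) by simp
  ultimately have B: "B \<in> carrier_mat (l m) (l m)" and BA: "B * A = 1\<^sub>m (l m)"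
    using BA by auto
  define f where "f = (\<lambda>(i, j). if i = m
    then (\<Sum>h = 1..l m. Const (A $$ (j - 1, h - 1)) * X m h) + \<psi> j else X i j)"
  define g where "g = (\<lambda>(i, j). if i = m
    then (\<Sum>h = 1..l m. Const (B $$ (j - 1, h - 1)) * (X m h - \<psi> h)) else X i j)"
  have \<psi>_ring: "\<psi> j \<in> poly_ring l n" if "j \<in> {1..l m}" for j
    using \<psi>(1)[OF that] by (rule poly_ring_mono[rotated]) (use m in auto)
  have f: "algebra_endomorphism l n (subst f)"
    by (rule algebra_endomorphism_subst) (use m \<psi>_ring in \<open>auto simp: f_def\<close>)
  have g: "algebra_endomorphism l n (subst g)"
    by (rule algebra_endomorphism_subst) (use m \<psi>_ring in \<open>auto simp: g_def\<close>)
  have f_fix: "subst f p = p" if "p \<in> poly_ring l (m - 1)" for p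
    using that by (rule subst_eq_self) (auto simp: f_def)
  have g_fix: "subst g p = p" if "p \<in> poly_ring l (m - 1)" for p
    using that by (rule subst_eq_self) (auto simp: g_def)
  have gf: "subst g (subst f (X i j)) = X i j" if "i \<in> {1..n}" "j \<in> {1..l i}" for i j
  proof (cases "i = m")
    case True
    with that have j: "j \<in> {1..l m}" by simp
    have "subst g (subst f (X i j)) = (\<Sum>k = 1..l m. Const (A $$ (j - 1, k - 1)) *
        (\<Sum>h = 1..l m. Const (B $$ (k - 1, h - 1)) * (X m h - \<psi> h))) + \<psi> j"
      using True g_fix[OF \<psi>(1)[OF j]]
      by (simp add: f_def subst_add subst_sum subst_mult) (simp add: g_def)
    also have "\<dots> = X i j"
      using inverse_linear_forms[OF B A(1) AB j, of "\<lambda>h. X m h - \<psi> h"] True by simp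
    finally show ?thesis .
  qed (simp add: f_def g_def)
  have fg: "subst f (subst g (X i j)) = X i j" if "i \<in> {1..n}" "j \<in> {1..l i}" for i j
  proof (cases "i = m")
    case True
    with that have j: "j \<in> {1..l m}" by simp
    have "subst f (subst g (X i j)) =
        (\<Sum>k = 1..l m. Const (B $$ (j - 1, k - 1)) * (subst f (X m k) - subst f (\<psi> k)))"
      using True by (simp add: g_def subst_sum subst_mult subst_diff)
    also have "\<dots> = (\<Sum>k = 1..l m. Const (B $$ (j - 1, k - 1)) *
        (\<Sum>h = 1..l m. Const (A $$ (k - 1, h - 1)) * X m h))"
      by (rule sum.cong) (use f_fix \<psi>(1) in \<open>auto simp: f_def\<close>)
    also have "\<dots> = X i j"
      using inverse_linear_forms[OF A(1) B BA j] True by simp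
    finally show ?thesis .
  qed (simp add: f_def g_def)
  have "homogeneous q d (subst f p)" if "p \<in> poly_ring l n" "homogeneous q d p" for d p
    by (rule homogeneous_subst[OF _ that]) (use \<psi>(2) in \<open>auto simp: f_def\<close>)
  then have "graded_automorphism q l n (subst f)"
    using f bij_betw_if_inverse_on_variables[OF f g gf fg]
    by (simp add: graded_automorphism_def)
  moreover have "\<forall>j \<in> {1..l m}. subst f (X m j) =
      (\<Sum>h = 1..l m. Const (A $$ (j - 1, h - 1)) * X m h) + \<psi> j"
    and "\<forall>i j. i \<noteq> m \<longrightarrow> subst f (X i j) = X i j"
    by (simp_all add: f_def)
  ultimately show ?thesis
    using f_fix by blast
qed

text \<open>
  The elementary parts are composed in the order of the groups, the first group innermost. Then the
  factor for group \<open>m + 1\<close> still finds the variables of this group unchanged, and fixes the images of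
  the earlier variables, which lie in the ring of the first \<open>m\<close> groups. In the opposite order the
  later factors would alter the polynomials \<open>\<psi>\<close>.
\<close>

lemma triangular_automorphism_exists:
  fixes A :: "nat \<Rightarrow> 'k::comm_ring_1 mat"
  assumes adm: "admissible_data q l n A \<psi>"
  shows "\<exists>\<phi>. graded_automorphism q l n \<phi> \<and> has_assignment l n A \<psi> \<phi>"
proof -
  define target where "target i j =
    (\<Sum>h = 1..l i. Const (A i $$ (j - 1, h - 1)) * X i h) + \<psi> i j" for i j
  have "\<exists>\<phi>. graded_automorphism q l n \<phi> \<and>
      (\<forall>i\<in>{1..n}. \<forall>j\<in>{1..l i}. \<phi> (X i j) = (if i \<le> m then target i j else X i j))"
    if "m \<le> n" for m
    using that
  proof (induction m)
    case 0
    show ?case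
      by (rule exI[of _ "\<lambda>p. p"]) (auto simp: graded_automorphism_id)
  next
    case (Suc m)
    then obtain \<phi> where \<phi>: "graded_automorphism q l n \<phi>"
      and \<phi>_X: "\<And>i j. i \<in> {1..n} \<Longrightarrow> j \<in> {1..l i} \<Longrightarrow>
        \<phi> (X i j) = (if i \<le> m then target i j else X i j)"
      by auto
    have m: "Suc m \<in> {1..n}" using Suc.prems by simp
    have data: "A (Suc m) \<in> carrier_mat (l (Suc m)) (l (Suc m))" "invertible_mat (A (Suc m))"
      "\<And>j. j \<in> {1..l (Suc m)} \<Longrightarrow> \<psi> (Suc m) j \<in> poly_ring l (Suc m - 1)"
      "\<And>j. j \<in> {1..l (Suc m)} \<Longrightarrow> homogeneous q (q (Suc m)) (\<psi> (Suc m) j)"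
      using adm m unfolding admissible_data_def by blast+
    obtain E where E: "graded_automorphism q l n E"
      and E_X: "\<forall>j \<in> {1..l (Suc m)}. E (X (Suc m) j) = target (Suc m) j"
      and E_other: "\<forall>i j. i \<noteq> Suc m \<longrightarrow> E (X i j) = X i j"
      and E_fix: "\<forall>p \<in> poly_ring l (Suc m - 1). E p = p"
      using elementary_automorphism[of "Suc m" n "A (Suc m)" l "\<psi> (Suc m)" q, OF m data]
      unfolding target_def by blast
    have target_ring: "target i j \<in> poly_ring l m"
      if i: "i \<in> {1..n}" "i \<le> m" and j: "j \<in> {1..l i}" for i j
    proof -
      have "\<psi> i j \<in> poly_ring l m"
        using adm i j by (intro poly_ring_mono[of "i - 1" m]) (auto simp: admissible_data_def)
      then show ?thesis
        unfolding target_def using i by (intro poly_ring_add poly_ring_sum poly_ring_mult) auto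
    qed
    have "(E \<circ> \<phi>) (X i j) = (if i \<le> Suc m then target i j else X i j)"
      if "i \<in> {1..n}" "j \<in> {1..l i}" for i j
    proof -
      consider "i \<le> m" | "i = Suc m" | "Suc m < i" by linarith
      then show ?thesis
      proof cases
        case 1
        then show ?thesis
          using \<phi>_X[OF that] E_fix target_ring[OF that(1) 1 that(2)] by simp
      next
        case 2
        then show ?thesis
          using \<phi>_X[OF that] E_X that by simp
      next
        case 3
        then show ?thesis
          using \<phi>_X[OF that] E_other by simp
      qed
    qed
    then show ?case
      using graded_automorphism_comp[OF E \<phi>] by blast
  qed
  from this[of n] show ?thesis
    by (auto simp: has_assignment_def target_def)
qed


section \<open>Graded automorphisms are triangular\<close>

text \<open>
  After the linear form in the group \<open>i\<close> has been subtracted, no variable of a group \<open>i' \<ge> i\<close>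
  is left: in a monomial of degree \<open>q i\<close> it would use up the whole degree, so that \<open>i' = i\<close> and the
  monomial is one of the variables whose coefficients were removed.
\<close>

lemma homogeneous_decomposition:
  fixes p :: "'k::comm_ring_1 mpoly"
  assumes q_pos: "\<forall>i \<in> {1..n}. 0 < q i" and q_incr: "strict_mono_on {1..n} q"
    and i: "i \<in> {1..n}" and p: "p \<in> poly_ring l n" "homogeneous q (q i) p"
  defines "\<psi> \<equiv> p - (\<Sum>h = 1..l i.
    Const (Poly_Mapping.lookup p (Poly_Mapping.single (i, h) (Suc 0))) * X i h)"
  shows "\<psi> \<in> poly_ring l (i - 1)" and "homogeneous q (q i) \<psi>"
proof -
  show hom: "homogeneous q (q i) \<psi>"
    unfolding \<psi>_def using p(2) by auto
  have ring: "\<psi> \<in> poly_ring l n"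
    unfolding \<psi>_def using p(1) i by auto
  have no_linear: "Poly_Mapping.lookup \<psi> (Poly_Mapping.single (i, h) (Suc 0)) = 0"
    if "h \<in> {1..l i}" for h
    using that
    by (simp add: \<psi>_def lookup_minus lookup_sum lookup_Const_mult lookup_variable if_distrib
        cong: if_cong)
  show "\<psi> \<in> poly_ring l (i - 1)"
  proof (rule poly_ringI)
    fix t assume t: "t \<in> Poly_Mapping.keys \<psi>"
    note t_keys = poly_ringD[OF ring t]
    show "Poly_Mapping.keys t \<subseteq> (SIGMA i:{1..i - 1}. {1..l i})"
    proof (rule subsetI, rule ccontr)
      fix v assume v: "v \<in> Poly_Mapping.keys t" and nv: "v \<notin> (SIGMA i:{1..i - 1}. {1..l i})"
      obtain i' j where ij: "v = (i', j)" by (cases v)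
      have i': "i' \<in> {1..n}" "j \<in> {1..l i'}" "i \<le> i'"
        using t_keys v nv ij by auto
      obtain t' where t': "t = Poly_Mapping.single v (Suc 0) + t'"
        and t'_keys: "Poly_Mapping.keys t' \<subseteq> Poly_Mapping.keys t"
        using v by (rule monomial_split)
      have deg: "q i = q i' + monomial_degree q t'"
        using homogeneousD[OF hom t] by (simp add: t' ij monomial_degree_add)
      have "i' = i"
      proof (rule ccontr)
        assume "i' \<noteq> i"
        then have "q i < q i'"
          using q_incr i i' by (intro strict_mono_onD[of "{1..n}" q]) auto
        with deg show False by simp
      qed
      moreover have "t' = 0"
      proof (rule ccontr)
        assume "t' \<noteq> 0"
        then have "0 < monomial_degree q t'"
          using t'_keys t_keys q_pos by (intro monomial_degree_pos) auto
        with deg \<open>i' = i\<close> show False by simp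
      qed
      ultimately show False
        using no_linear[of j] t i' by (auto simp: t' ij in_keys_iff)
    qed
  qed
qed

text \<open>
  It suffices to see that a term of \<open>p\<close> that is not a variable of group \<open>i\<close> contributes nothing to the
  coefficient of \<open>X i h\<close> in \<open>\<phi> p\<close>. The image of a monomial is homogeneous of the same degree, so only
  monomials of degree \<open>q i\<close> matter. Such a monomial, if it is not a variable, is a product of two
  monomials of positive degree; their images have no constant term, so the product has no
  linear term.
\<close>

lemma linear_coefficients_image:
  fixes \<phi> :: "'k::comm_ring_1 mpoly \<Rightarrow> 'k mpoly"
  assumes q_pos: "\<forall>i \<in> {1..n}. 0 < q i" and q_inj: "inj_on q {1..n}"
    and endo: "algebra_endomorphism l n \<phi>"
    and graded: "\<And>d p. p \<in> poly_ring l n \<Longrightarrow> homogeneous q d p \<Longrightarrow> homogeneous q d (\<phi> p)"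
    and i: "i \<in> {1..n}" and h: "h \<in> {1..l i}" and p: "p \<in> poly_ring l n"
  shows "Poly_Mapping.lookup (\<phi> p) (Poly_Mapping.single (i, h) (Suc 0)) =
    (\<Sum>k = 1..l i. Poly_Mapping.lookup p (Poly_Mapping.single (i, k) (Suc 0)) *
      Poly_Mapping.lookup (\<phi> (X i k)) (Poly_Mapping.single (i, h) (Suc 0)))"
proof -
  let ?V = "SIGMA i:{1..n}. {1..l i}"
  let ?x = "\<lambda>k. Poly_Mapping.single (i, k) (Suc 0)"
  have closed: "\<phi> p \<in> poly_ring l n" if "p \<in> poly_ring l n" for p
    using that endo by (simp add: algebra_endomorphism_def)
  have add: "\<phi> (p + r) = \<phi> p + \<phi> r" if "p \<in> poly_ring l n" "r \<in> poly_ring l n" for p r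
    using that endo by (simp add: algebra_endomorphism_def)
  have mult: "\<phi> (p * r) = \<phi> p * \<phi> r" if "p \<in> poly_ring l n" "r \<in> poly_ring l n" for p r
    using that endo by (simp add: algebra_endomorphism_def)
  have const: "\<phi> (Const c) = Const c" for c
    using endo by (simp add: algebra_endomorphism_def)
  have monom_ring: "Poly_Mapping.single t (1 :: 'k) \<in> poly_ring l n" if "Poly_Mapping.keys t \<subseteq> ?V" for t
    using that by (intro poly_ringI) auto
  have monom_hom: "homogeneous q (monomial_degree q t) (\<phi> (Poly_Mapping.single t 1))"
    if "Poly_Mapping.keys t \<subseteq> ?V" for t
    using monom_ring[OF that] by (rule graded) (auto simp: homogeneous_def)
  have not_linear: "Poly_Mapping.lookup (\<phi> (Poly_Mapping.single t 1)) (?x h) = 0"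
    if t: "Poly_Mapping.keys t \<subseteq> ?V" and not_var: "\<And>k. k \<in> {1..l i} \<Longrightarrow> t \<noteq> ?x k" for t
  proof (rule ccontr)
    assume "Poly_Mapping.lookup (\<phi> (Poly_Mapping.single t 1)) (?x h) \<noteq> 0"
    then have key: "?x h \<in> Poly_Mapping.keys (\<phi> (Poly_Mapping.single t 1))"
      by (simp add: in_keys_iff)
    have deg: "monomial_degree q t = q i"
      using homogeneousD[OF monom_hom[OF t] key] by simp
    then have "t \<noteq> 0"
      using bspec[OF q_pos i] by auto
    then obtain v where v: "v \<in> Poly_Mapping.keys t"
      using keys_eq_empty by blast
    obtain i' j where ij: "v = (i', j)" by (cases v)
    have range: "i' \<in> {1..n}" "j \<in> {1..l i'}"
      using v ij t by auto
    obtain t' where t': "t = Poly_Mapping.single v (Suc 0) + t'"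
      and "Poly_Mapping.keys t' \<subseteq> Poly_Mapping.keys t"
      using v by (rule monomial_split)
    then have t'_keys: "Poly_Mapping.keys t' \<subseteq> ?V" and
      v_keys: "Poly_Mapping.keys (Poly_Mapping.single v (Suc 0)) \<subseteq> ?V"
      using t v by auto
    \<comment> \<open>Different groups have different weights, so \<open>t\<close> cannot be a variable of another group.\<close>
    have "t' \<noteq> 0"
    proof
      assume "t' = 0"
      with deg have "q i' = q i" by (simp add: t' ij)
      then have "i' = i" using q_inj range i by (auto dest: inj_onD)
      then show False using not_var[of j] range \<open>t' = 0\<close> by (simp add: t' ij)
    qed
    then have t'_pos: "0 < monomial_degree q t'"
      using t'_keys q_pos by (intro monomial_degree_pos) auto
    have prod: "\<phi> (Poly_Mapping.single t 1) =
        \<phi> (Poly_Mapping.single (Poly_Mapping.single v (Suc 0)) 1) * \<phi> (Poly_Mapping.single t' 1)"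
      using mult[OF monom_ring[OF v_keys] monom_ring[OF t'_keys]] by (simp add: mult_single t')
    obtain a b where ab: "?x h = a + b"
      and a: "a \<in> Poly_Mapping.keys (\<phi> (Poly_Mapping.single (Poly_Mapping.single v (Suc 0)) 1))"
      and b: "b \<in> Poly_Mapping.keys (\<phi> (Poly_Mapping.single t' 1))"
      using subsetD[OF keys_mult key[unfolded prod]] by blast
    have "monomial_degree q a = q i'" "monomial_degree q b = monomial_degree q t'"
      using homogeneousD[OF monom_hom[OF v_keys] a] homogeneousD[OF monom_hom[OF t'_keys] b]
      by (auto simp: ij)
    then have "a \<noteq> 0" "b \<noteq> 0"
      using bspec[OF q_pos range(1)] t'_pos by auto
    with variable_eq_add[OF ab] show False by simp
  qed
  show ?thesis
  proof (rule poly_terms_induct[where T = "{t. Poly_Mapping.keys t \<subseteq> ?V}" and p = p])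
    show "Poly_Mapping.keys p \<subseteq> {t. Poly_Mapping.keys t \<subseteq> ?V}"
      using poly_ringD[OF p] by blast
    show "Poly_Mapping.lookup (\<phi> 0) (?x h) =
        (\<Sum>k = 1..l i. Poly_Mapping.lookup 0 (?x k) * Poly_Mapping.lookup (\<phi> (X i k)) (?x h))"
      using const[of 0] by simp
  next
    fix t :: monomial and c :: 'k
    assume "t \<in> {t. Poly_Mapping.keys t \<subseteq> ?V}"
    then have t: "Poly_Mapping.keys t \<subseteq> ?V" by simp
    have "\<phi> (Poly_Mapping.single t c) = Const c * \<phi> (Poly_Mapping.single t 1)"
      unfolding single_eq_Const_mult[of t c] using mult[OF _ monom_ring[OF t]] const by simp
    then have "Poly_Mapping.lookup (\<phi> (Poly_Mapping.single t c)) (?x h) =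
        c * Poly_Mapping.lookup (\<phi> (Poly_Mapping.single t 1)) (?x h)"
      by (simp add: lookup_Const_mult)
    also have "\<dots> = (\<Sum>k = 1..l i. Poly_Mapping.lookup (Poly_Mapping.single t c) (?x k) *
        Poly_Mapping.lookup (\<phi> (X i k)) (?x h))"
    proof (cases "\<exists>k\<in>{1..l i}. t = ?x k")
      case True
      then obtain k where k: "k \<in> {1..l i}" "t = ?x k" by blast
      then show ?thesis
        by (simp add: lookup_single when_def single_variable_eq_iff X_def if_distribR
            if_distrib[of "\<lambda>a. a * _"] cong: if_cong)
    next
      case False
      then show ?thesis
        using not_linear[OF t] by (auto simp: lookup_single when_def intro!: sum.neutral)
    qed
    finally show "Poly_Mapping.lookup (\<phi> (Poly_Mapping.single t c)) (?x h) =
        (\<Sum>k = 1..l i. Poly_Mapping.lookup (Poly_Mapping.single t c) (?x k) *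
          Poly_Mapping.lookup (\<phi> (X i k)) (?x h))" .
  next
    fix p r :: "'k mpoly"
    assume *: "Poly_Mapping.keys p \<subseteq> {t. Poly_Mapping.keys t \<subseteq> ?V}"
      "Poly_Mapping.keys r \<subseteq> {t. Poly_Mapping.keys t \<subseteq> ?V}"
      and IH: "Poly_Mapping.lookup (\<phi> p) (?x h) = (\<Sum>k = 1..l i.
          Poly_Mapping.lookup p (?x k) * Poly_Mapping.lookup (\<phi> (X i k)) (?x h))"
        "Poly_Mapping.lookup (\<phi> r) (?x h) = (\<Sum>k = 1..l i.
          Poly_Mapping.lookup r (?x k) * Poly_Mapping.lookup (\<phi> (X i k)) (?x h))"
    from * have "p \<in> poly_ring l n" "r \<in> poly_ring l n"
      unfolding poly_ring_def by blast+
    then show "Poly_Mapping.lookup (\<phi> (p + r)) (?x h) = (\<Sum>k = 1..l i.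
        Poly_Mapping.lookup (p + r) (?x k) * Poly_Mapping.lookup (\<phi> (X i k)) (?x h))"
      by (simp add: add lookup_add IH sum.distrib algebra_simps)
  qed
qed

lemma graded_automorphism_triangular:
  fixes \<phi> :: "'k::field mpoly \<Rightarrow> 'k mpoly"
  assumes q_pos: "\<forall>i \<in> {1..n}. 0 < q i" and q_incr: "strict_mono_on {1..n} q"
    and \<phi>: "graded_automorphism q l n \<phi>"
  shows "\<exists>A \<psi>. admissible_data q l n A \<psi> \<and> has_assignment l n A \<psi> \<phi>"
proof -
  let ?x = "\<lambda>i k. Poly_Mapping.single (i, k) (Suc 0)"
  have endo: "algebra_endomorphism l n \<phi>" and bij: "bij_betw \<phi> (poly_ring l n) (poly_ring l n)"
    and graded: "\<And>d p. p \<in> poly_ring l n \<Longrightarrow> homogeneous q d p \<Longrightarrow> homogeneous q d (\<phi> p)"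
    using \<phi> by (auto simp: graded_automorphism_def)
  define A where "A i = mat (l i) (l i)
    (\<lambda>(j, h). Poly_Mapping.lookup (\<phi> (X i (Suc j))) (?x i (Suc h)))" for i
  define \<psi> where "\<psi> i j = \<phi> (X i j) -
    (\<Sum>h = 1..l i. Const (Poly_Mapping.lookup (\<phi> (X i j)) (?x i h)) * X i h)" for i j
  have A_index: "A i $$ (j - 1, h - 1) = Poly_Mapping.lookup (\<phi> (X i j)) (?x i h)"
    if "j \<in> {1..l i}" "h \<in> {1..l i}" for i j h
    using that by (cases j; cases h) (auto simp: A_def)
  have A_inv: "invertible_mat (A i)" if i: "i \<in> {1..n}" for i
  proof -
    define pre where "pre = inv_into (poly_ring l n) \<phi>"
    have pre: "pre p \<in> poly_ring l n" "\<phi> (pre p) = p" if "p \<in> poly_ring l n" for p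
      using bij that unfolding pre_def bij_betw_def
      by (metis inv_into_into, metis f_inv_into_f)
    \<comment> \<open>The rows of the inverse are the linear coefficients of the preimages of the \<open>X i j\<close>.\<close>
    define B where "B = mat (l i) (l i)
      (\<lambda>(j, k). Poly_Mapping.lookup (pre (X i (Suc j))) (?x i (Suc k)))"
    have B_index: "B $$ (j - 1, k - 1) = Poly_Mapping.lookup (pre (X i j)) (?x i k)"
      if "j \<in> {1..l i}" "k \<in> {1..l i}" for j k
      using that by (cases j; cases k) (auto simp: B_def)
    have A: "A i \<in> carrier_mat (l i) (l i)" and B: "B \<in> carrier_mat (l i) (l i)"
      by (auto simp: A_def B_def)
    have entry: "(B * A i) $$ (j - 1, h - 1) = (if j = h then 1 else 0)"
      if j: "j \<in> {1..l i}" and h: "h \<in> {1..l i}" for j h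
    proof -
      have Xij: "X i j \<in> poly_ring l n" using i j by simp
      have "(B * A i) $$ (j - 1, h - 1) =
          (\<Sum>k = 1..l i. B $$ (j - 1, k - 1) * A i $$ (k - 1, h - 1))"
        using sum_mat_mult_index[OF B A j h] by simp
      also have "\<dots> = (\<Sum>k = 1..l i. Poly_Mapping.lookup (pre (X i j)) (?x i k) *
          Poly_Mapping.lookup (\<phi> (X i k)) (?x i h))"
        by (rule sum.cong) (use A_index B_index j h in auto)
      also have "\<dots> = Poly_Mapping.lookup (\<phi> (pre (X i j))) (?x i h)"
        by (rule linear_coefficients_image[OF q_pos strict_mono_on_imp_inj_on[OF q_incr] endo
              graded i h pre(1)[OF Xij], symmetric])
      also have "\<dots> = (if j = h then 1 else 0)"
        by (auto simp: pre(2)[OF Xij] lookup_variable)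
      finally show ?thesis .
    qed
    have "B * A i = 1\<^sub>m (l i)"
    proof (rule eq_matI)
      fix j h assume "j < dim_row (1\<^sub>m (l i) :: 'k mat)" "h < dim_col (1\<^sub>m (l i) :: 'k mat)"
      then show "(B * A i) $$ (j, h) = 1\<^sub>m (l i) $$ (j, h)"
        using entry[of "Suc j" "Suc h"] by simp
    qed (use A B in auto)
    moreover from this have "A i * B = 1\<^sub>m (l i)"
      by (rule mat_mult_left_right_inverse[OF B A])
    ultimately show ?thesis
      using A B by (auto simp: invertible_mat_def inverts_mat_def intro!: exI[of _ B])
  qed
  have "\<psi> i j \<in> poly_ring l (i - 1) \<and> homogeneous q (q i) (\<psi> i j)"
    if ij: "i \<in> {1..n}" "j \<in> {1..l i}" for i j
  proof -
    have ring: "\<phi> (X i j) \<in> poly_ring l n"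
      using endo ij by (simp add: algebra_endomorphism_def)
    have hom: "homogeneous q (q i) (\<phi> (X i j))"
      using ij by (intro graded poly_ring_X homogeneous_X)
    show ?thesis
      unfolding \<psi>_def
      by (intro conjI homogeneous_decomposition[OF q_pos q_incr ij(1) ring hom])
  qed
  then have "admissible_data q l n A \<psi>"
    using A_inv by (auto simp: admissible_data_def A_def)
  moreover have "has_assignment l n A \<psi> \<phi>"
    unfolding has_assignment_def
  proof (intro ballI)
    fix i j assume "i \<in> {1..n}" "j \<in> {1..l i}"
    then show "\<phi> (X i j) = (\<Sum>h = 1..l i. Const (A i $$ (j - 1, h - 1)) * X i h) + \<psi> i j"
      unfolding \<psi>_def using A_index by simp
  qed
  ultimately show ?thesis by blast
qed

theorem proposition1p1:
  fixes q l :: "nat \<Rightarrow> nat" and n :: nat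
  assumes q_pos: "\<forall>i \<in> {1..n}. 0 < q i"
    and q_incr: "strict_mono_on {1..n} q"
  shows
    "(\<forall>(A :: nat \<Rightarrow> 'k::field_char_0 mat) \<psi>. admissible_data q l n A \<psi> \<longrightarrow>
        (\<exists>\<phi>. graded_automorphism q l n \<phi> \<and> has_assignment l n A \<psi> \<phi> \<and>
           (\<forall>\<phi>'. algebra_endomorphism l n \<phi>' \<and> has_assignment l n A \<psi> \<phi>' \<longrightarrow>
              (\<forall>p \<in> poly_ring l n. \<phi>' p = \<phi> p)))) \<and>
     (\<forall>\<phi> :: 'k mpoly \<Rightarrow> 'k mpoly. graded_automorphism q l n \<phi> \<longrightarrow>
        (\<exists>A \<psi>. admissible_data q l n A \<psi> \<and> has_assignment l n A \<psi> \<phi>))"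
proof (intro conjI allI impI)
  fix A :: "nat \<Rightarrow> 'k mat" and \<psi>
  assume "admissible_data q l n A \<psi>"
  then obtain \<phi> where \<phi>: "graded_automorphism q l n \<phi>" "has_assignment l n A \<psi> \<phi>"
    using triangular_automorphism_exists by blast
  moreover have "\<phi>' p = \<phi> p" if "algebra_endomorphism l n \<phi>'" "has_assignment l n A \<psi> \<phi>'"
    and "p \<in> poly_ring l n" for \<phi>' p
    using that(1) _ _ that(3)
    by (rule algebra_endomorphism_eqI)
      (use \<phi> that in \<open>auto simp: graded_automorphism_def has_assignment_def\<close>)
  ultimately show "\<exists>\<phi>. graded_automorphism q l n \<phi> \<and> has_assignment l n A \<psi> \<phi> \<and>
      (\<forall>\<phi>'. algebra_endomorphism l n \<phi>' \<and> has_assignment l n A \<psi> \<phi>' \<longrightarrow>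
        (\<forall>p \<in> poly_ring l n. \<phi>' p = \<phi> p))"
    by blast
next
  fix \<phi> :: "'k mpoly \<Rightarrow> 'k mpoly"
  assume "graded_automorphism q l n \<phi>"
  then show "\<exists>A \<psi>. admissible_data q l n A \<psi> \<and> has_assignment l n A \<psi> \<phi>"
    by (rule graded_automorphism_triangular[OF q_pos q_incr])
qed

end
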